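(* Let $f:\mathbb{R}\to\mathbb{R}$ be continuously differentiable and convex, let $\alpha\in(0,1]$, and let $x,c\in\mathbb{R}$ with $x\neq c$. Then $${}^{C}D^{\alpha}_{c}f(x)\le\frac{f'(x)(x-c)}{\Gamma(2-\alpha)|x-c|^{\alpha}} .$$
   Context: $\Gamma$ is the gamma function. For $0<\alpha<1$ and $x\ne c$ (either $x>c$ or $x<c$), the Caputo derivative of order $\alpha$ with terminal $c$ is $${}^{C}D^{\alpha}_{c}f(x)=\frac{1}{\Gamma(1-\alpha)}\int_c^x\frac{f'(t)}{|x-t|^{\alpha}}\,dt,$$ where $\int_c^x$ is the oriented integral. Convention at $\alpha=1$: ${}^{C}D^{1}_{c}f(x)$ is the limiting value $\operatorname{sgn}(x-c)f'(x)$, where $\operatorname{sgn}$ is the sign function. *)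

theory Defs
  imports "HOL-Analysis.Analysis"
begin

text \<open>
  Caputo derivative of order \<open>\<alpha>\<close>, \<open>0 < \<alpha> \<le> 1\<close>, with terminal \<open>c\<close>, at a point \<open>x \<noteq> c\<close>.
  The interval integral is oriented: it changes sign for \<open>x < c\<close>. The library value of the
  integrand at the singularity \<open>t = x\<close> is irrelevant, as the integral is over the open interval.
  For \<open>0 < \<alpha> < 1\<close> and continuously differentiable \<open>f\<close> the integrand is absolutely integrable.
  The value at \<open>\<alpha> = 1\<close> is a convention, namely the limit for \<open>\<alpha>\<close> tending to 1 from below.
\<close>
definition caputo_deriv :: "real \<Rightarrow> real \<Rightarrow> (real \<Rightarrow> real) \<Rightarrow> real \<Rightarrow> real" where
  "caputo_deriv \<alpha> c f x =
    (if \<alpha> = 1 then sgn (x - c) * deriv f x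
     else 1 / Gamma (1 - \<alpha>) * (LBINT t=ereal c..ereal x. deriv f t / \<bar>x - t\<bar> powr \<alpha>))"

end

theory Submission
  imports Defs
begin

text \<open>
  A convex differentiable function has a nondecreasing derivative. If \<open>c < x\<close>, then
  \<open>f' t \<le> f' x\<close> on the range of integration; if \<open>x < c\<close>, then \<open>f' t \<ge> f' x\<close> there, but the
  oriented integral carries a minus sign. So in both cases the Caputo derivative does not
  decrease when \<open>f' t\<close> is replaced by the constant \<open>f' x\<close>, and what remains is the integral
  of the kernel \<open>1 / \<bar>x - t\<bar> powr \<alpha>\<close> between \<open>c\<close> and \<open>x\<close>, which has absolute value
  \<open>\<bar>x - c\<bar> powr (1 - \<alpha>) / (1 - \<alpha>)\<close> (\<open>kernel_integral\<close>). The functional equation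
  \<open>\<Gamma>(2 - \<alpha>) = (1 - \<alpha>) \<Gamma>(1 - \<alpha>)\<close> turns the resulting constant into the stated one.

  The comparison of integrals requires both integrands to be integrable in spite of the
  singularity at \<open>t = x\<close>. This holds because the exponent is less than 1 and because the
  continuous function \<open>f'\<close> is bounded between \<open>c\<close> and \<open>x\<close>
  (\<open>continuous_over_kernel_integrable\<close>). At \<open>\<alpha> = 1\<close> the two sides are equal.
\<close>

text \<open>
  The kernel has an antiderivative that stays continuous at the singularity, since
  \<open>1 - \<alpha>\<close> is positive. Either end of the interval may be the singularity: both cases are
  needed, one for each side of \<open>x\<close> on which the terminal can lie.
\<close>

lemma kernel_integral:
  fixes a b x \<alpha> :: real
  assumes "a < b" and "x = a \<or> x = b" and "\<alpha> < 1"
  shows "set_integrable lborel {a<..<b} (\<lambda>t. 1 / \<bar>x - t\<bar> powr \<alpha>)"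
    and "(LBINT t:{a<..<b}. 1 / \<bar>x - t\<bar> powr \<alpha>) = (b - a) powr (1 - \<alpha>) / (1 - \<alpha>)"
proof -
  \<comment> \<open>The sign of \<open>t - x\<close> inside the interval.\<close>
  define s :: real where "s = (if x = a then 1 else - 1)"
  define F where "F = (\<lambda>t. s * \<bar>x - t\<bar> powr (1 - \<alpha>) / (1 - \<alpha>))"
  have abs_eq: "\<bar>x - t\<bar> = s * (t - x)" and pos: "0 < s * (t - x)" if "a < t" "t < b" for t
    using that assms(2) by (auto simp: s_def)
  have ss: "s * s = 1"
    by (simp add: s_def)
  have deriv: "DERIV F t :> 1 / \<bar>x - t\<bar> powr \<alpha>" if "ereal a < ereal t" "ereal t < ereal b" for t
  proof -
    have t: "a < t" "t < b" using that by auto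
    have "DERIV (\<lambda>t. s * (s * (t - x)) powr (1 - \<alpha>) / (1 - \<alpha>)) t :>
        s * ((1 - \<alpha>) * (s * (t - x)) powr (1 - \<alpha> - 1) * s) / (1 - \<alpha>)"
      using pos[OF t] by (auto intro!: derivative_eq_intros)
    also have "s * ((1 - \<alpha>) * (s * (t - x)) powr (1 - \<alpha> - 1) * s) / (1 - \<alpha>)
        = (s * s) * (s * (t - x)) powr (- \<alpha>)"
      using assms(3) by simp
    also have "\<dots> = 1 / \<bar>x - t\<bar> powr \<alpha>"
      by (simp only: abs_eq[OF t] ss powr_minus_divide mult_1)
    finally have "DERIV (\<lambda>t. s * (s * (t - x)) powr (1 - \<alpha>) / (1 - \<alpha>)) t :> 1 / \<bar>x - t\<bar> powr \<alpha>" .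
    then show ?thesis
      by (rule has_field_derivative_transform_within_open[where S = "{a<..<b}"])
        (use t in \<open>auto simp: F_def abs_eq\<close>)
  qed
  have cont: "isCont (\<lambda>t. 1 / \<bar>x - t\<bar> powr \<alpha>) t" if "ereal a < ereal t" "ereal t < ereal b" for t
    using that assms(2) by (intro continuous_intros) auto
  have "continuous_on UNIV F"
    unfolding F_def using assms(3) by (intro continuous_on_powr' continuous_intros) auto
  then have contF: "isCont F t" for t
    by (simp add: continuous_on_eq_continuous_at)
  have lim_a: "((F \<circ> real_of_ereal) \<longlongrightarrow> F a) (at_right (ereal a))"
    and lim_b: "((F \<circ> real_of_ereal) \<longlongrightarrow> F b) (at_left (ereal b))"
    using contF by (auto simp: ereal_tendsto_simps continuous_at_imp_continuous_at_within
        simp flip: continuous_within)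
  note FTC = interval_integral_FTC_nonneg[OF _ deriv cont _ lim_a lim_b]
  show "set_integrable lborel {a<..<b} (\<lambda>t. 1 / \<bar>x - t\<bar> powr \<alpha>)"
    using FTC(1) assms(1) by simp
  have "(LBINT t:{a<..<b}. 1 / \<bar>x - t\<bar> powr \<alpha>) = F b - F a"
    using FTC(2) assms(1) by (simp add: interval_integral_Ioo)
  also have "\<dots> = (b - a) powr (1 - \<alpha>) / (1 - \<alpha>)"
    using assms by (auto simp: F_def s_def)
  finally show "(LBINT t:{a<..<b}. 1 / \<bar>x - t\<bar> powr \<alpha>) = (b - a) powr (1 - \<alpha>) / (1 - \<alpha>)" .
qed

text \<open>
  A bound for \<open>\<bar>h\<bar>\<close> on the compact interval, times the kernel, dominates the integrand.
\<close>

lemma continuous_over_kernel_integrable: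
  fixes a b x \<alpha> :: real and h :: "real \<Rightarrow> real"
  assumes "a < b" and "x = a \<or> x = b" and "\<alpha> < 1" and h: "continuous_on {a..b} h"
  shows "set_integrable lborel {a<..<b} (\<lambda>t. h t / \<bar>x - t\<bar> powr \<alpha>)"
proof -
  have "bounded (h ` {a..b})"
    using h by (intro compact_imp_bounded compact_continuous_image) auto
  then obtain B where B: "\<And>t. t \<in> {a..b} \<Longrightarrow> \<bar>h t\<bar> \<le> B"
    by (force simp: bounded_iff)
  have "continuous_on {a<..<b} h"
    by (rule continuous_on_subset[OF h]) auto
  then have "continuous_on {a<..<b} (\<lambda>t. h t / \<bar>x - t\<bar> powr \<alpha>)"
    using assms(2) by (intro continuous_intros) auto
  then have meas: "set_borel_measurable lborel {a<..<b} (\<lambda>t. h t / \<bar>x - t\<bar> powr \<alpha>)"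
    unfolding set_borel_measurable_def measurable_lborel2
    by (intro borel_measurable_continuous_on_indicator) auto
  show ?thesis
  proof (rule set_integrable_bound)
    show "set_integrable lborel {a<..<b} (\<lambda>t. B * (1 / \<bar>x - t\<bar> powr \<alpha>))"
      using kernel_integral(1)[OF assms(1-3)] by (rule set_integrable_mult_right)
    have "norm (h t / \<bar>x - t\<bar> powr \<alpha>) \<le> norm (B * (1 / \<bar>x - t\<bar> powr \<alpha>))"
      if "t \<in> {a<..<b}" for t
      using B[of t] that by (auto simp: abs_mult intro!: divide_right_mono)
    then show "AE t in lborel. t \<in> {a<..<b} \<longrightarrow>
        norm (h t / \<bar>x - t\<bar> powr \<alpha>) \<le> norm (B * (1 / \<bar>x - t\<bar> powr \<alpha>))"
      by simp
  qed (rule meas)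
qed

text \<open>
  Each of the tangents at two points lies below the graph at the other point; adding the
  two inequalities gives \<open>(f' v - f' u) * (v - u) \<ge> 0\<close>.
\<close>

lemma convex_on_imp_mono_deriv:
  fixes f :: "real \<Rightarrow> real"
  assumes "convex_on UNIV f" and f': "\<And>t. DERIV f t :> f' t"
  shows "mono f'"
proof (rule monoI)
  fix u v :: real
  assume "u \<le> v"
  have tangent: "f' p * (q - p) \<le> f q - f p" for p q
    using convex_on_imp_above_tangent[OF assms(1), of p q "f' p"] f'[of p] by simp
  have "0 \<le> (f' v - f' u) * (v - u)"
    using tangent[of u v] tangent[of v u] by (simp add: algebra_simps)
  then show "f' u \<le> f' v"
    using \<open>u \<le> v\<close> by (cases "u = v") (auto simp: zero_le_mult_iff)
qed

theorem corollary3p5: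
  fixes f :: "real \<Rightarrow> real" and \<alpha> x c :: real
  assumes "f C1_differentiable_on UNIV"
    and "convex_on UNIV f"
    and "0 < \<alpha>" and "\<alpha> \<le> 1"
    and "x \<noteq> c"
  shows "caputo_deriv \<alpha> c f x \<le> deriv f x * (x - c) / (Gamma (2 - \<alpha>) * \<bar>x - c\<bar> powr \<alpha>)"
proof (cases "\<alpha> = 1")
  case True
  then show ?thesis
    by (simp add: caputo_deriv_def real_sgn_eq mult.commute)
next
  case False
  then have \<alpha>: "\<alpha> < 1"
    using assms(4) by simp
  obtain D where D: "\<And>t. (f has_vector_derivative D t) (at t)" and "continuous_on UNIV D"
    using assms(1) unfolding C1_differentiable_on_def by auto
  have D_deriv: "\<And>t. DERIV f t :> D t"
    using D by (simp add: has_real_derivative_iff_has_vector_derivative)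
  then have "deriv f = D"
    by (intro ext DERIV_imp_deriv)
  then have f': "\<And>t. DERIV f t :> deriv f t"
    using D_deriv by simp
  have cont: "continuous_on S (deriv f)" for S
    using \<open>continuous_on UNIV D\<close> \<open>deriv f = D\<close> continuous_on_subset by blast
  have mono: "mono (deriv f)"
    using convex_on_imp_mono_deriv[OF assms(2) f'] .
  define d where "d = \<bar>x - c\<bar>"
  define K where "K = d powr (1 - \<alpha>) / (1 - \<alpha>)"
  have const: "(LBINT t:{a<..<b}. deriv f x / \<bar>x - t\<bar> powr \<alpha>) = deriv f x * K"
    "set_integrable lborel {a<..<b} (\<lambda>t. deriv f x / \<bar>x - t\<bar> powr \<alpha>)"
    if "a < b" "x = a \<or> x = b" "b - a = d" for a b
    using kernel_integral(2)[OF that(1,2) \<alpha>] that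
      set_integral_mult_right[of lborel "{a<..<b}" "deriv f x" "\<lambda>t. 1 / \<bar>x - t\<bar> powr \<alpha>"]
      continuous_over_kernel_integrable[OF that(1,2) \<alpha>, of "\<lambda>_. deriv f x"]
    by (simp_all add: K_def)
  note integrable = continuous_over_kernel_integrable[OF _ _ \<alpha> cont]
  have le: "(LBINT t=ereal c..ereal x. deriv f t / \<bar>x - t\<bar> powr \<alpha>) \<le> sgn (x - c) * deriv f x * K"
  proof (cases "c < x")
    case True
    have "(LBINT t:{c<..<x}. deriv f t / \<bar>x - t\<bar> powr \<alpha>)
        \<le> (LBINT t:{c<..<x}. deriv f x / \<bar>x - t\<bar> powr \<alpha>)"
      using True mono
      by (intro set_integral_mono integrable const(2)) (auto simp: d_def monoD intro!: divide_right_mono)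
    then show ?thesis
      using True const(1)[of c x] by (simp add: interval_integral_Ioo d_def)
  next
    case False
    then have "x < c"
      using assms(5) by simp
    have "(LBINT t:{x<..<c}. deriv f x / \<bar>x - t\<bar> powr \<alpha>)
        \<le> (LBINT t:{x<..<c}. deriv f t / \<bar>x - t\<bar> powr \<alpha>)"
      using \<open>x < c\<close> mono
      by (intro set_integral_mono integrable const(2)) (auto simp: d_def monoD intro!: divide_right_mono)
    then show ?thesis
      using \<open>x < c\<close> const(1)[of x c]
      by (subst interval_integral_endpoints_reverse) (simp add: interval_integral_Ioo d_def)
  qed
  have Gamma_pos: "0 < Gamma (1 - \<alpha>)"
    using \<alpha> by (intro Gamma_real_pos) simp
  have Gamma_eq: "Gamma (2 - \<alpha>) = (1 - \<alpha>) * Gamma (1 - \<alpha>)"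
    using Gamma_plus1[of "1 - \<alpha>"] nonpos_Ints_nonpos[of "1 - \<alpha>"] \<alpha> by force
  have "caputo_deriv \<alpha> c f x \<le> sgn (x - c) * deriv f x * K / Gamma (1 - \<alpha>)"
    using le Gamma_pos False by (simp add: caputo_deriv_def divide_right_mono)
  also have "\<dots> = deriv f x * (sgn (x - c) * d) / (Gamma (2 - \<alpha>) * d powr \<alpha>)"
    using assms(5) by (simp add: K_def Gamma_eq powr_diff d_def mult_ac)
  also have "sgn (x - c) * d = x - c"
    by (simp add: d_def sgn_mult_abs)
  finally show ?thesis
    by (simp add: d_def)
qed

end
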